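(* Let $\lambda$ be a partition and $k=|\lambda|$. For each oscillating tableau $T=(\lambda^0,\ldots,\lambda^l)$ let $\mathrm{wt}_{1,1}(T):=\sum_{i=0}^{l}|\lambda^i|\cdot i$. Then for any $n\in\mathbb{N}$, $$\frac{1}{\#\mathcal{OT}(\lambda,k+2n)}\sum_{T\in\mathcal{OT}(\lambda,k+2n)}\mathrm{wt}_{1,1}(T)=(k+2n+1)\cdot\frac{2k^2+2n^2+5kn+k}{6}.$$
   Context: $\mathbb{N}=\{0,1,2,\ldots\}$. A partition is a finite weakly decreasing sequence of positive integers (the empty sequence $\emptyset$ is allowed); its size $|\lambda|$ is the sum of its parts, and it is identified with its Young diagram. An oscillating tableau of shape $\lambda$ and length $l$ is a sequence of partitions $T=(\lambda^0,\lambda^1,\ldots,\lambda^l)$ with $\lambda^0=\emptyset$, $\lambda^l=\lambda$, and, for each $0\le i\le l-1$, $\lambda^{i+1}$ obtained from $\lambda^i$ by adding one box to or removing one box from its Young diagram. $\mathcal{OT}(\lambda,l)$ denotes the set of oscillating tableaux of shape $\lambda$ and length $l$. *)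

theory Defs
  imports Complex_Main
begin

definition is_partition :: "nat list \<Rightarrow> bool" where
  "is_partition p \<longleftrightarrow> sorted_wrt (\<ge>) p \<and> (\<forall>x\<in>set p. 0 < x)"

definition psize :: "nat list \<Rightarrow> nat" where
  "psize p = sum_list p"

(* Rows and columns are numbered from 0. *)
definition young_diagram :: "nat list \<Rightarrow> (nat \<times> nat) set" where
  "young_diagram p = {(i, j). i < length p \<and> j < p ! i}"

definition adds_box :: "nat list \<Rightarrow> nat list \<Rightarrow> bool" where
  "adds_box p q \<longleftrightarrow> (\<exists>b. b \<notin> young_diagram p \<and> young_diagram q = insert b (young_diagram p))"

(* A tableau of length l is a list of l + 1 partitions. *)
definition osc_tableaux :: "nat list \<Rightarrow> nat \<Rightarrow> nat list list set" where
  "osc_tableaux p l = {T. length T = l + 1 \<and> (\<forall>q\<in>set T. is_partition q) \<and>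
     T ! 0 = [] \<and> T ! l = p \<and>
     (\<forall>i<l. adds_box (T ! i) (T ! (i + 1)) \<or> adds_box (T ! (i + 1)) (T ! i))}"

definition wt11 :: "nat list list \<Rightarrow> nat" where
  "wt11 T = (\<Sum>i<length T. psize (T ! i) * i)"

end

(* Let f(p) be the number of standard Young tableaux of shape p. Summing f over the partitions
   below p gives f(p), and summing it over the partitions above p gives (|p| + 1) f(p), by the
   commutation relation DU - UD = 1 in Young's lattice. Deleting the last partition of an
   oscillating tableau therefore shows, by induction on the length l, that the number and the
   total weight of the tableaux of shape p are f(p) times quantities that depend only on l and
   k = |p|. For l = k + 2 n the resulting two-term recursion on (k, n) is solved by
   (k + 2 n)! / (k! n! 2^n) for the number, and by this times the stated polynomial for the
   weight. *)

theory Submission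
  imports Defs
begin

section \<open>Row-length functions: adding and removing cells\<close>

text \<open>Padding with zeros makes the addition of a box a pointwise update, even where it starts
  a new row.\<close>

definition row :: "nat list \<Rightarrow> nat \<Rightarrow> nat" where
  "row p i = (if i < length p then p ! i else 0)"

definition shape :: "(nat \<Rightarrow> nat) \<Rightarrow> bool" where
  "shape f \<longleftrightarrow> antimono f \<and> finite {i. f i \<noteq> 0}"

text \<open>Row 0 is listed separately because \<open>i - 1\<close> would be 0 again by truncated
  subtraction.\<close>

definition addable :: "(nat \<Rightarrow> nat) \<Rightarrow> nat set" where
  "addable f = {i. i = 0 \<or> f i < f (i - 1)}"

definition removable :: "(nat \<Rightarrow> nat) \<Rightarrow> nat set" where
  "removable f = {i. f (Suc i) < f i}"

abbreviation add_cell :: "(nat \<Rightarrow> nat) \<Rightarrow> nat \<Rightarrow> nat \<Rightarrow> nat" where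
  "add_cell f i \<equiv> f(i := Suc (f i))"

abbreviation remove_cell :: "(nat \<Rightarrow> nat) \<Rightarrow> nat \<Rightarrow> nat \<Rightarrow> nat" where
  "remove_cell f i \<equiv> f(i := f i - 1)"

lemma finite_removable: "shape f \<Longrightarrow> finite (removable f)"
  unfolding shape_def removable_def by (auto elim: rev_finite_subset)

text \<open>A row below the top one can grow exactly if the row above it can shrink. The extra row 0
  is the source of the constant 1 in the commutation relation.\<close>

lemma addable_eq: "addable f = insert 0 (Suc ` removable f)"
proof -
  have "i \<in> addable f \<longleftrightarrow> i \<in> insert 0 (Suc ` removable f)" for i
    by (cases i) (auto simp: addable_def removable_def)
  then show ?thesis by blast
qed

lemma finite_addable: "shape f \<Longrightarrow> finite (addable f)"
  by (simp add: addable_eq finite_removable)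

lemma card_addable: "shape f \<Longrightarrow> card (addable f) = Suc (card (removable f))"
  by (simp add: addable_eq finite_removable card_image)

lemma shape_iff: "shape f \<longleftrightarrow> (\<forall>i. f (Suc i) \<le> f i) \<and> finite {i. f i \<noteq> 0}"
  unfolding shape_def antimono_iff_le_Suc by simp

lemma shape_add_cell:
  assumes "shape f" "i \<in> addable f"
  shows "shape (add_cell f i)"
proof -
  have "{j. add_cell f i j \<noteq> 0} \<subseteq> insert i {j. f j \<noteq> 0}"
    by auto
  moreover have "add_cell f i (Suc j) \<le> add_cell f i j" for j
    using assms by (auto simp: shape_iff addable_def le_SucI)
  ultimately show ?thesis
    using assms(1) unfolding shape_iff by (meson finite_insert finite_subset)
qed

lemma shape_remove_cell:
  assumes "shape f" "i \<in> removable f"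
  shows "shape (remove_cell f i)"
proof -
  have "{j. remove_cell f i j \<noteq> 0} \<subseteq> {j. f j \<noteq> 0}"
    by auto
  moreover have "remove_cell f i (Suc j) \<le> remove_cell f i j" for j
  proof -
    have "f (Suc j) \<le> f j" "f (Suc i) < f i"
      using assms by (auto simp: shape_iff removable_def)
    then show ?thesis by auto
  qed
  ultimately show ?thesis
    using assms(1) unfolding shape_iff by (meson finite_insert finite_subset)
qed

lemma removable_add_cell: "shape f \<Longrightarrow> i \<in> addable f \<Longrightarrow> i \<in> removable (add_cell f i)"
  by (auto simp: removable_def shape_iff le_imp_less_Suc)

lemma addable_remove_cell:
  assumes "shape f" "i \<in> removable f"
  shows "i \<in> addable (remove_cell f i)"
proof (cases i)
  case (Suc j)
  then have "f i \<le> f j" "0 < f i"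
    using assms by (auto simp: shape_iff removable_def)
  then show ?thesis using Suc by (auto simp: addable_def)
qed (simp add: addable_def)

section \<open>The commutation relation and the numbers of standard Young tableaux\<close>

text \<open>The two conditions interact only if \<open>j + 1 = i\<close>, and then either order asks
  row \<open>j\<close> to exceed row \<open>i\<close> by at least two.\<close>

lemma swap_add_remove:
  assumes "shape f" "i \<noteq> j"
  shows "i \<in> addable f \<and> j \<in> removable (add_cell f i) \<longleftrightarrow>
         j \<in> removable f \<and> i \<in> addable (remove_cell f j)"
  using assms by (cases i) (auto simp: addable_def removable_def split: if_splits)

text \<open>The relation \<open>DU - UD = 1\<close> of Young's lattice holds because up-down and down-up paths with distinct
  endpoints correspond, and there is one more addable row than removable rows.\<close>

lemma add_remove_commute:
  fixes F :: "(nat \<Rightarrow> nat) \<Rightarrow> real"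
  assumes f: "shape f"
  shows "(\<Sum>i\<in>addable f. \<Sum>j\<in>removable (add_cell f i). F (remove_cell (add_cell f i) j)) =
         F f + (\<Sum>j\<in>removable f. \<Sum>i\<in>addable (remove_cell f j). F (add_cell (remove_cell f j) i))"
proof -
  let ?A = "SIGMA i:addable f. removable (add_cell f i) - {i}"
  let ?B = "SIGMA j:removable f. addable (remove_cell f j) - {j}"
  have fA: "finite (removable (add_cell f i))" if "i \<in> addable f" for i
    using that f finite_removable shape_add_cell by blast
  have fB: "finite (addable (remove_cell f i))" if "i \<in> removable f" for i
    using that f finite_addable shape_remove_cell by blast
  \<comment> \<open>Removing the cell just added gives \<open>f\<close> back; this diagonal term is
    split off for every addable row.\<close>
  have "(\<Sum>i\<in>addable f. \<Sum>j\<in>removable (add_cell f i). F (remove_cell (add_cell f i) j)) =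
        (\<Sum>i\<in>addable f. F f + (\<Sum>j\<in>removable (add_cell f i) - {i}. F (remove_cell (add_cell f i) j)))"
    using f fA by (intro sum.cong refl) (simp add: sum.remove[OF _ removable_add_cell])
  also have "\<dots> = card (addable f) * F f + (\<Sum>(i,j)\<in>?A. F (remove_cell (add_cell f i) j))"
    using f fA by (simp add: sum.distrib sum.Sigma finite_addable del: fun_upd_apply)
  also have "(\<Sum>(i,j)\<in>?A. F (remove_cell (add_cell f i) j)) =
             (\<Sum>(j,i)\<in>?B. F (add_cell (remove_cell f j) i))"
  proof -
    have mem: "(a, b) \<in> ?A \<longleftrightarrow> (b, a) \<in> ?B" for a b
      using swap_add_remove[OF f, of a b] by auto
    have upd: "F (add_cell (remove_cell f b) a) = F (remove_cell (add_cell f a) b)"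
      if "(a, b) \<in> ?A" for a b
      using that by (auto simp: fun_upd_twist)
    show ?thesis
    proof (rule sum.reindex_bij_witness[where i = prod.swap and j = prod.swap])
      fix x assume x: "x \<in> ?A"
      show "prod.swap x \<in> ?B"
        using x by (cases x) (simp only: swap_simp mem)
      show "(case prod.swap x of (j, i) \<Rightarrow> F (add_cell (remove_cell f j) i)) =
            (case x of (i, j) \<Rightarrow> F (remove_cell (add_cell f i) j))"
        using x by (cases x) (simp only: swap_simp prod.case upd)
    next
      fix x assume x: "x \<in> ?B"
      show "prod.swap x \<in> ?A"
        using x by (cases x) (simp only: swap_simp mem)
    qed simp_all
  qed
  also have "\<dots> = (\<Sum>j\<in>removable f. \<Sum>i\<in>addable (remove_cell f j) - {j}. F (add_cell (remove_cell f j) i))"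
    using f fB by (simp add: sum.Sigma finite_removable del: fun_upd_apply)
  \<comment> \<open>One copy of \<open>F f\<close> stays in front; the others, one for each
    removable row, supply the diagonal terms of the down-up sum.\<close>
  also have "card (addable f) * F f + \<dots> = F f +
      (\<Sum>j\<in>removable f. F f + (\<Sum>i\<in>addable (remove_cell f j) - {j}. F (add_cell (remove_cell f j) i)))"
    using f by (simp add: sum.distrib card_addable distrib_right del: fun_upd_apply)
  also have "(\<Sum>j\<in>removable f. F f + (\<Sum>i\<in>addable (remove_cell f j) - {j}. F (add_cell (remove_cell f j) i))) =
             (\<Sum>j\<in>removable f. \<Sum>i\<in>addable (remove_cell f j). F (add_cell (remove_cell f j) i))"
  proof (intro sum.cong refl)
    fix j assume j: "j \<in> removable f"
    then have "add_cell (remove_cell f j) j = f" by (auto simp: removable_def)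
    then show "F f + (\<Sum>i\<in>addable (remove_cell f j) - {j}. F (add_cell (remove_cell f j) i)) =
               (\<Sum>i\<in>addable (remove_cell f j). F (add_cell (remove_cell f j) i))"
      using sum.remove[OF fB[OF j] addable_remove_cell[OF f j],
          of "\<lambda>i. F (add_cell (remove_cell f j) i)"]
      by (simp del: fun_upd_apply)
  qed
  finally show ?thesis .
qed

text \<open>For a shape with \<open>m\<close> cells this is the number of standard Young tableaux;
  for other shapes it vanishes.\<close>

primrec num_syt :: "nat \<Rightarrow> (nat \<Rightarrow> nat) \<Rightarrow> real" where
  "num_syt 0 f = (if f = (\<lambda>_. 0) then 1 else 0)"
| "num_syt (Suc m) f = (\<Sum>i\<in>removable f. num_syt m (remove_cell f i))"

text \<open>Unfolding \<open>num_syt\<close> gives an up-down sum, which the commutation relation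
  turns into one copy of \<open>num_syt m f\<close> plus a down-up sum. The latter gives
  \<open>m\<close> further copies by induction; for \<open>m = 0\<close> it vanishes, since a shape
  that has just gained a cell is not empty.\<close>

lemma sum_num_syt_add:
  assumes "shape f"
  shows "(\<Sum>i\<in>addable f. num_syt (Suc m) (add_cell f i)) = real (Suc m) * num_syt m f"
  using assms
proof (induction m arbitrary: f)
  case 0
  have "num_syt 0 (add_cell g i) = 0" for g i
  proof -
    have "add_cell g i i \<noteq> 0" by simp
    then show ?thesis unfolding num_syt.simps by metis
  qed
  then show ?case
    unfolding num_syt.simps(2)
    using add_remove_commute[OF 0, of "num_syt 0"] by (simp del: num_syt.simps fun_upd_apply)
next
  case (Suc m)
  have "(\<Sum>j\<in>removable f. \<Sum>i\<in>addable (remove_cell f j). num_syt (Suc m) (add_cell (remove_cell f j) i)) =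
        (\<Sum>j\<in>removable f. real (Suc m) * num_syt m (remove_cell f j))"
    using Suc shape_remove_cell by (intro sum.cong refl) blast
  also have "\<dots> = real (Suc m) * num_syt (Suc m) f"
    by (simp add: sum_distrib_left)
  finally show ?case
    using add_remove_commute[OF Suc.prems, of "num_syt (Suc m)"]
    unfolding num_syt.simps(2)[of "Suc m"] by (simp add: distrib_right del: num_syt.simps fun_upd_apply)
qed

section \<open>Translation between partitions and row-length functions\<close>

lemma young_diagram_row: "young_diagram p = {(i, j). j < row p i}"
  by (auto simp: young_diagram_def row_def split: if_splits)

lemma finite_young_diagram: "finite (young_diagram p)"
  and card_young_diagram: "card (young_diagram p) = psize p"
proof -
  have *: "young_diagram p = (SIGMA i:{0..<length p}. {..<p ! i})"
    by (auto simp: young_diagram_def)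
  show "finite (young_diagram p)" unfolding * by simp
  show "card (young_diagram p) = psize p"
    unfolding * psize_def sum_list_sum_nth by simp
qed

lemma psize_adds_box: "adds_box p q \<Longrightarrow> psize q = Suc (psize p)"
  by (auto simp: adds_box_def finite_young_diagram simp flip: card_young_diagram)

text \<open>Each row of a diagram is an initial segment, hence determined by its cardinality.
  Inserting one box therefore lengthens one row by one and leaves the others alone.\<close>

lemma adds_box_iff_row: "adds_box p q \<longleftrightarrow> (\<exists>i. row q = add_cell (row p) i)"
proof
  assume "adds_box p q"
  then obtain i j where ij: "(i, j) \<notin> young_diagram p" "young_diagram q = insert (i, j) (young_diagram p)"
    by (auto simp: adds_box_def)
  have eq: "{..<row q i'} = (if i' = i then insert j {..<row p i'} else {..<row p i'})" for i'
    using ij(2) by (auto simp: young_diagram_row set_eq_iff)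
  have "row q i' = add_cell (row p) i i'" for i'
    using arg_cong[OF eq[of i'], of card] ij(1) by (auto simp: young_diagram_row split: if_splits)
  then show "\<exists>i. row q = add_cell (row p) i" by blast
next
  assume "\<exists>i. row q = add_cell (row p) i"
  then obtain i where i: "row q = add_cell (row p) i" by blast
  have "young_diagram q = insert (i, row p i) (young_diagram p)"
    unfolding young_diagram_row i by (auto split: if_splits)
  then show "adds_box p q"
    by (auto simp: adds_box_def young_diagram_row)
qed

lemma shape_row:
  assumes "is_partition p"
  shows "shape (row p)"
proof -
  have "{i. row p i \<noteq> 0} \<subseteq> {..<length p}"
    by (auto simp: row_def)
  then show ?thesis
    using assms by (auto simp: shape_iff is_partition_def row_def sorted_wrt_iff_nth_less
        intro: finite_subset)
qed

text \<open>As all parts are positive, the length of the list can be read off from the support of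
  \<open>row p\<close>.\<close>

lemma inj_row: "inj_on row (Collect is_partition)"
proof (rule inj_onI)
  fix p q assume pq: "p \<in> Collect is_partition" "q \<in> Collect is_partition" and eq: "row p = row q"
  have *: "i < length p \<longleftrightarrow> row p i \<noteq> 0" if "is_partition p" for p i
    using that by (auto simp: is_partition_def row_def)
  have len: "i < length p \<longleftrightarrow> i < length q" for i
    using pq * eq by auto
  then have "length p = length q"
    by (meson linorder_neqE_nat less_irrefl)
  then show "p = q"
    by (rule nth_equalityI) (use eq len in \<open>metis row_def\<close>)
qed

lemma row_surj:
  assumes "shape f"
  obtains p where "is_partition p" "row p = f"
proof -
  \<comment> \<open>The first empty row gives the length of the partition: by monotonicity all rows
    after it are empty too.\<close>
  define n where "n = (LEAST i. f i = 0)"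
  have "\<exists>i. f i = 0"
    using assms unfolding shape_def by (metis (mono_tags) ex_new_if_finite infinite_UNIV_nat mem_Collect_eq)
  then have "f n = 0"
    unfolding n_def by (rule LeastI_ex)
  then have zero: "f i = 0" if "n \<le> i" for i
    using that assms antimonoD[of f n i] by (simp add: shape_def)
  have pos: "0 < f i" if "i < n" for i
    using that not_less_Least unfolding n_def by blast
  have "is_partition (map f [0..<n])"
    using pos assms by (auto simp: is_partition_def sorted_wrt_iff_nth_less shape_def antimono_def)
  moreover have "row (map f [0..<n]) = f"
    using zero by (auto simp: row_def)
  ultimately show ?thesis using that by blast
qed

section \<open>Neighbours in Young's lattice\<close>

lemma shape_add_cellD:
  assumes "shape (add_cell f i)"
  shows "i \<in> addable f"
proof (cases i)
  case (Suc j)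
  then have "add_cell f i (Suc j) \<le> add_cell f i j"
    using assms by (simp add: shape_iff del: fun_upd_apply)
  then show ?thesis using Suc by (simp add: addable_def)
qed (simp add: addable_def)

lemma inj_add_cell: "inj (add_cell f)"
  by (rule injI) (metis fun_upd_apply n_not_Suc_n)

text \<open>\<open>covers p\<close> and \<open>cocovers p\<close> together are the possible
  predecessors of \<open>p\<close> in an oscillating tableau.\<close>

definition covers :: "nat list \<Rightarrow> nat list set" where
  "covers p = {q. is_partition q \<and> adds_box p q}"

definition cocovers :: "nat list \<Rightarrow> nat list set" where
  "cocovers p = {q. is_partition q \<and> adds_box q p}"

lemma bij_covers:
  assumes "is_partition p"
  shows "bij_betw row (covers p) (add_cell (row p) ` addable (row p))"
proof -
  have "row ` covers p = add_cell (row p) ` addable (row p)"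
  proof (intro equalityI subsetI)
    fix f assume "f \<in> row ` covers p"
    then obtain q i where "is_partition q" "f = row q" "f = add_cell (row p) i"
      unfolding covers_def adds_box_iff_row by blast
    moreover from this have "i \<in> addable (row p)"
      using shape_add_cellD shape_row by metis
    ultimately show "f \<in> add_cell (row p) ` addable (row p)" by blast
  next
    fix f assume "f \<in> add_cell (row p) ` addable (row p)"
    then obtain i where i: "i \<in> addable (row p)" "f = add_cell (row p) i" by blast
    then obtain q where "is_partition q" "row q = f"
      using row_surj[OF shape_add_cell[OF shape_row[OF assms] i(1)]] by blast
    then show "f \<in> row ` covers p"
      using i(2) unfolding covers_def adds_box_iff_row by blast
  qed
  then show ?thesis
    using inj_row by (auto simp: bij_betw_def covers_def intro: inj_on_subset)
qed

text \<open>Positivity of \<open>f i\<close> rules out the truncated subtraction, which would leave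
  \<open>f\<close> unchanged.\<close>

lemma add_cell_eq_iff: "f = add_cell g i \<longleftrightarrow> 0 < f i \<and> g = remove_cell f i"
  by auto

lemma shape_remove_cellD:
  assumes "shape (remove_cell f i)" "0 < f i"
  shows "i \<in> removable f"
proof -
  have "remove_cell f i (Suc i) \<le> remove_cell f i i"
    using assms by (simp add: shape_iff del: fun_upd_apply)
  then show ?thesis using assms(2) by (simp add: removable_def)
qed

lemma bij_cocovers:
  assumes "is_partition p"
  shows "bij_betw row (cocovers p) (remove_cell (row p) ` removable (row p))"
proof -
  have "row ` cocovers p = remove_cell (row p) ` removable (row p)"
  proof (intro equalityI subsetI)
    fix f assume "f \<in> row ` cocovers p"
    then obtain q i where "is_partition q" "f = row q" "0 < row p i" "f = remove_cell (row p) i"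
      unfolding cocovers_def adds_box_iff_row add_cell_eq_iff by blast
    moreover from this have "i \<in> removable (row p)"
      using shape_remove_cellD shape_row by metis
    ultimately show "f \<in> remove_cell (row p) ` removable (row p)" by blast
  next
    fix f assume "f \<in> remove_cell (row p) ` removable (row p)"
    then obtain i where i: "i \<in> removable (row p)" "f = remove_cell (row p) i" by blast
    then have "0 < row p i" by (auto simp: removable_def)
    moreover obtain q where "is_partition q" "row q = f"
      using i(2) row_surj[OF shape_remove_cell[OF shape_row[OF assms] i(1)]] by blast
    ultimately show "f \<in> row ` cocovers p"
      using i(2) unfolding cocovers_def adds_box_iff_row add_cell_eq_iff by blast
  qed
  then show ?thesis
    using inj_row by (auto simp: bij_betw_def cocovers_def intro: inj_on_subset)
qed

text \<open>Removable rows are nonempty, so the row that gets shorter reveals the index; for empty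
  rows \<open>remove_cell\<close> gives back \<open>f\<close> itself.\<close>

lemma inj_on_remove_cell: "inj_on (remove_cell f) (removable f)"
proof (rule inj_onI)
  fix i j assume "i \<in> removable f" "j \<in> removable f" "remove_cell f i = remove_cell f j"
  then have "0 < f i" "remove_cell f i i = remove_cell f j i"
    by (auto simp: removable_def)
  then show "i = j" by (auto split: if_splits)
qed

lemma finite_covers: "is_partition p \<Longrightarrow> finite (covers p)"
  and finite_cocovers: "is_partition p \<Longrightarrow> finite (cocovers p)"
  using bij_betw_finite[OF bij_covers] bij_betw_finite[OF bij_cocovers]
    finite_addable finite_removable shape_row by (metis finite_imageI)+

lemma sum_num_syt_covers:
  assumes "is_partition p"
  shows "(\<Sum>q\<in>covers p. num_syt (Suc m) (row q)) = real (Suc m) * num_syt m (row p)"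
proof -
  have "(\<Sum>q\<in>covers p. num_syt (Suc m) (row q)) =
        (\<Sum>f\<in>add_cell (row p) ` addable (row p). num_syt (Suc m) f)"
    by (rule sum.reindex_bij_betw[OF bij_covers[OF assms]])
  also have "\<dots> = (\<Sum>i\<in>addable (row p). num_syt (Suc m) (add_cell (row p) i))"
    by (rule sum.reindex_cong[OF inj_on_subset[OF inj_add_cell]]) auto
  finally show ?thesis
    using sum_num_syt_add[OF shape_row[OF assms]] by simp
qed

lemma sum_num_syt_cocovers:
  assumes "is_partition p"
  shows "(\<Sum>q\<in>cocovers p. num_syt m (row q)) = num_syt (Suc m) (row p)"
proof -
  have "(\<Sum>q\<in>cocovers p. num_syt m (row q)) =
        (\<Sum>f\<in>remove_cell (row p) ` removable (row p). num_syt m f)"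
    by (rule sum.reindex_bij_betw[OF bij_cocovers[OF assms]])
  also have "\<dots> = num_syt (Suc m) (row p)"
    unfolding sum.reindex[OF inj_on_remove_cell] by simp
  finally show ?thesis .
qed

lemma is_partition_psize_0: "is_partition p \<Longrightarrow> psize p = 0 \<longleftrightarrow> p = []"
  by (cases p) (auto simp: is_partition_def psize_def)

lemma row_Nil: "row [] = (\<lambda>_. 0)"
  by (auto simp: row_def)

text \<open>Allows this factor to be cancelled from the mean. The last nonempty row can be
  shortened, so the recursion has at least one summand, and all summands are positive by
  induction.\<close>

lemma num_syt_pos: "is_partition p \<Longrightarrow> 0 < num_syt (psize p) (row p)"
proof (induction "psize p" arbitrary: p)
  case 0
  then show ?case using is_partition_psize_0[of p] by (simp add: row_Nil psize_def)
next
  case (Suc m)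
  let ?f = "row p" and ?S = "{i. row p i \<noteq> 0}"
  have sh: "shape ?f" using Suc by (simp add: shape_row)
  have "p \<noteq> []" using Suc by (auto simp: psize_def)
  then have "0 \<in> ?S"
    using Suc.prems by (auto simp: is_partition_def row_def)
  then have M: "Max ?S \<in> ?S" "finite ?S"
    using sh Max_in[of ?S] by (auto simp: shape_def)
  then have "Suc (Max ?S) \<notin> ?S"
    using Max_ge[of ?S "Suc (Max ?S)"] by (metis not_less_eq_eq order_refl)
  then have "Max ?S \<in> removable ?f"
    using M by (simp add: removable_def)
  then have "cocovers p \<noteq> {}"
    using bij_betw_empty2[of row "cocovers p"] bij_cocovers[OF Suc.prems]
    by (metis bij_betw_imp_surj_on empty_iff imageI image_is_empty)
  moreover have "0 < num_syt m (row q)" if "q \<in> cocovers p" for q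
    using that Suc.hyps psize_adds_box[of q p] by (auto simp: cocovers_def)
  ultimately have "0 < (\<Sum>q\<in>cocovers p. num_syt m (row q))"
    using Suc.prems by (intro sum_pos finite_cocovers) auto
  then show ?case
    unfolding sum_num_syt_cocovers[OF Suc.prems] using Suc.hyps by metis
qed

lemma covers_Int_cocovers: "covers p \<inter> cocovers p = {}"
proof -
  have False if "adds_box p q" "adds_box q p" for q
    using that[THEN psize_adds_box] by simp
  then show ?thesis by (auto simp: covers_def cocovers_def)
qed

text \<open>This drives the inductions over the length: summing over neighbours preserves the form
  \<open>num_syt\<close> times a function of the size. The size is constant on covers and on
  cocovers, so \<open>\<phi>\<close> factors out of both sums.\<close>

lemma sum_neighbours:
  fixes \<phi> :: "nat \<Rightarrow> real"
  assumes p: "is_partition p"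
  shows "(\<Sum>q\<in>covers p \<union> cocovers p. num_syt (psize q) (row q) * \<phi> (psize q)) =
         num_syt (psize p) (row p) *
           ((case psize p of 0 \<Rightarrow> 0 | Suc k \<Rightarrow> \<phi> k) + real (Suc (psize p)) * \<phi> (Suc (psize p)))"
proof -
  have "(\<Sum>q\<in>covers p. num_syt (psize q) (row q) * \<phi> (psize q)) =
        (\<Sum>q\<in>covers p. num_syt (Suc (psize p)) (row q)) * \<phi> (Suc (psize p))"
    unfolding sum_distrib_right
    by (intro sum.cong refl) (auto simp: covers_def psize_adds_box simp del: num_syt.simps)
  then have up: "(\<Sum>q\<in>covers p. num_syt (psize q) (row q) * \<phi> (psize q)) =
        num_syt (psize p) (row p) * (real (Suc (psize p)) * \<phi> (Suc (psize p)))"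
    unfolding sum_num_syt_covers[OF p] by simp
  have down: "(\<Sum>q\<in>cocovers p. num_syt (psize q) (row q) * \<phi> (psize q)) =
        num_syt (psize p) (row p) * (case psize p of 0 \<Rightarrow> 0 | Suc k \<Rightarrow> \<phi> k)"
  proof (cases "psize p")
    case 0
    \<comment> \<open>A cocover has one cell fewer, so the empty partition has none; hence the value
      0 in the case distinction.\<close>
    then have "cocovers p = {}"
      using psize_adds_box by (fastforce simp: cocovers_def)
    then show ?thesis using 0 by simp
  next
    case (Suc k)
    then have *: "psize q = k" if "q \<in> cocovers p" for q
      using that psize_adds_box[of q p] by (simp add: cocovers_def)
    have "(\<Sum>q\<in>cocovers p. num_syt (psize q) (row q) * \<phi> (psize q)) =
          (\<Sum>q\<in>cocovers p. num_syt k (row q)) * \<phi> k"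
      unfolding sum_distrib_right by (intro sum.cong refl) (simp add: *)
    then show ?thesis
      unfolding sum_num_syt_cocovers[OF p] Suc by (simp del: num_syt.simps)
  qed
  show ?thesis
    using p up down
    by (simp add: sum.union_disjoint finite_covers finite_cocovers covers_Int_cocovers
        algebra_simps del: num_syt.simps)
qed

section \<open>Removing the last partition of an oscillating tableau\<close>

lemma osc_tableaux_Suc:
  assumes "is_partition p"
  shows "osc_tableaux p (Suc l) = (\<Union>q\<in>covers p \<union> cocovers p. (\<lambda>T. T @ [p]) ` osc_tableaux q l)"
proof (intro equalityI subsetI)
  fix T assume T: "T \<in> osc_tableaux p (Suc l)"
  define S where "S = butlast T"
  have len: "length T = Suc (Suc l)" using T by (simp add: osc_tableaux_def)
  then have "T = S @ [last T]" unfolding S_def by (cases T rule: rev_cases) auto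
  moreover have "last T = p"
    using T len by (subst last_conv_nth) (auto simp: osc_tableaux_def)
  ultimately have TS: "T = S @ [p]" by simp
  then have lS: "length S = Suc l" using len by simp
  have step: "adds_box (T ! i) (T ! (i + 1)) \<or> adds_box (T ! (i + 1)) (T ! i)" if "i < Suc l" for i
    using T that by (simp add: osc_tableaux_def)
  have nth: "T ! i = S ! i" if "i \<le> l" for i
    using that lS by (simp add: TS nth_append)
  have part: "\<forall>q\<in>set S. is_partition q"
    using T by (auto simp: osc_tableaux_def TS)
  have "S \<in> osc_tableaux (S ! l) l"
    unfolding osc_tableaux_def
  proof (intro CollectI conjI allI impI)
    show "S ! 0 = []" using T nth[of 0] by (simp add: osc_tableaux_def)
    fix i assume "i < l"
    then show "adds_box (S ! i) (S ! (i + 1)) \<or> adds_box (S ! (i + 1)) (S ! i)"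
      using step[of i] nth[of i] nth[of "i + 1"] by simp
  qed (use part lS in auto)
  moreover have "S ! l \<in> covers p \<union> cocovers p"
    using step[of l] part lS by (auto simp: TS nth_append covers_def cocovers_def)
  ultimately show "T \<in> (\<Union>q\<in>covers p \<union> cocovers p. (\<lambda>T. T @ [p]) ` osc_tableaux q l)"
    using TS by blast
next
  fix T assume "T \<in> (\<Union>q\<in>covers p \<union> cocovers p. (\<lambda>T. T @ [p]) ` osc_tableaux q l)"
  then obtain q S where q: "adds_box p q \<or> adds_box q p" and S: "S \<in> osc_tableaux q l"
    and T: "T = S @ [p]"
    by (auto simp: covers_def cocovers_def)
  have lS: "length S = Suc l" and last: "S ! l = q" using S by (auto simp: osc_tableaux_def)
  have "adds_box (T ! i) (T ! (i + 1)) \<or> adds_box (T ! (i + 1)) (T ! i)" if "i < Suc l" for i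
  proof (cases "i = l")
    case True
    then show ?thesis using q last lS by (auto simp: T nth_append)
  next
    case False
    then show ?thesis using that S lS by (auto simp: T nth_append osc_tableaux_def)
  qed
  then show "T \<in> osc_tableaux p (Suc l)"
    using S lS assms by (auto simp: osc_tableaux_def T nth_append)
qed

lemma osc_tableaux_0: "osc_tableaux p 0 = (if p = [] then {[[]]} else {})"
  by (auto simp: osc_tableaux_def is_partition_def length_Suc_conv)

lemma finite_osc_tableaux: "is_partition p \<Longrightarrow> finite (osc_tableaux p l)"
proof (induction l arbitrary: p)
  case (Suc l)
  then show ?case
    unfolding osc_tableaux_Suc[OF Suc.prems]
    by (auto simp: finite_covers finite_cocovers) (auto simp: covers_def cocovers_def)
qed (simp add: osc_tableaux_0)

text \<open>The union over \<open>q\<close> is disjoint because the truncated tableau ends in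
  \<open>q\<close>, and appending \<open>p\<close> is injective.\<close>

lemma sum_osc_tableaux_Suc:
  fixes H :: "nat list list \<Rightarrow> real"
  assumes p: "is_partition p"
  shows "(\<Sum>T\<in>osc_tableaux p (Suc l). H T) =
         (\<Sum>q\<in>covers p \<union> cocovers p. \<Sum>T\<in>osc_tableaux q l. H (T @ [p]))"
proof -
  have "(\<Sum>T\<in>osc_tableaux p (Suc l). H T) =
        (\<Sum>q\<in>covers p \<union> cocovers p. \<Sum>T\<in>(\<lambda>T. T @ [p]) ` osc_tableaux q l. H T)"
    unfolding osc_tableaux_Suc[OF p]
  proof (rule sum.UNION_disjoint)
    show "finite (covers p \<union> cocovers p)"
      using p by (simp add: finite_covers finite_cocovers)
    show "\<forall>q\<in>covers p \<union> cocovers p. finite ((\<lambda>T. T @ [p]) ` osc_tableaux q l)"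
      by (auto simp: covers_def cocovers_def finite_osc_tableaux)
    show "\<forall>q\<in>covers p \<union> cocovers p. \<forall>r\<in>covers p \<union> cocovers p. q \<noteq> r \<longrightarrow>
      (\<lambda>T. T @ [p]) ` osc_tableaux q l \<inter> (\<lambda>T. T @ [p]) ` osc_tableaux r l = {}"
      by (auto simp: osc_tableaux_def)
  qed
  then show ?thesis by (simp add: sum.reindex inj_on_def)
qed

section \<open>Recursions for the number and the total weight\<close>

text \<open>The number of tableaux of length \<open>l\<close> and of a shape with \<open>k\<close>
  cells, divided by the number of standard Young tableaux of that shape. The recursion is that of
  \<open>sum_neighbours\<close>.\<close>

primrec osc_count :: "nat \<Rightarrow> nat \<Rightarrow> real" where
  "osc_count 0 k = (if k = 0 then 1 else 0)"
| "osc_count (Suc l) k =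
     (case k of 0 \<Rightarrow> 0 | Suc j \<Rightarrow> osc_count l j) + real (Suc k) * osc_count l (Suc k)"

text \<open>The total weight, normalised in the same way. The last summand collects the contribution
  of the final partition, which has index \<open>Suc l\<close> in every tableau.\<close>

primrec osc_weight :: "nat \<Rightarrow> nat \<Rightarrow> real" where
  "osc_weight 0 k = 0"
| "osc_weight (Suc l) k =
     (case k of 0 \<Rightarrow> 0 | Suc j \<Rightarrow> osc_weight l j) + real (Suc k) * osc_weight l (Suc k)
       + real k * real (Suc l) * osc_count (Suc l) k"

lemma card_osc_tableaux:
  "is_partition p \<Longrightarrow>
   real (card (osc_tableaux p l)) = num_syt (psize p) (row p) * osc_count l (psize p)"
proof (induction l arbitrary: p)
  case 0
  then show ?case
    using is_partition_psize_0[of p] by (auto simp: osc_tableaux_0 row_Nil psize_def)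
next
  case (Suc l)
  have "real (card (osc_tableaux p (Suc l))) = (\<Sum>T\<in>osc_tableaux p (Suc l). 1)"
    by simp
  also have "\<dots> = (\<Sum>q\<in>covers p \<union> cocovers p. real (card (osc_tableaux q l)))"
    unfolding sum_osc_tableaux_Suc[OF Suc.prems] by simp
  also have "\<dots> = (\<Sum>q\<in>covers p \<union> cocovers p. num_syt (psize q) (row q) * osc_count l (psize q))"
    by (intro sum.cong refl Suc.IH) (auto simp: covers_def cocovers_def)
  finally show ?case
    unfolding sum_neighbours[OF Suc.prems] by simp
qed

lemma wt11_snoc: "length T = Suc l \<Longrightarrow> wt11 (T @ [p]) = wt11 T + psize p * Suc l"
  by (simp add: wt11_def nth_append)

lemma sum_wt11_osc_tableaux:
  "is_partition p \<Longrightarrow>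
   (\<Sum>T\<in>osc_tableaux p l. real (wt11 T)) = num_syt (psize p) (row p) * osc_weight l (psize p)"
proof (induction l arbitrary: p)
  case 0
  then show ?case
    by (auto simp: osc_tableaux_0 wt11_def psize_def)
next
  case (Suc l)
  let ?N = "covers p \<union> cocovers p"
  have "(\<Sum>T\<in>osc_tableaux p (Suc l). real (wt11 T)) =
        (\<Sum>q\<in>?N. \<Sum>T\<in>osc_tableaux q l. real (wt11 T) + real (psize p) * real (Suc l))"
    unfolding sum_osc_tableaux_Suc[OF Suc.prems]
    by (intro sum.cong refl) (auto simp: osc_tableaux_def wt11_snoc distrib_left)
  \<comment> \<open>The final partition adds the same amount to every tableau, so its total is that
    amount times the number of tableaux.\<close>
  also have "\<dots> = (\<Sum>q\<in>?N. \<Sum>T\<in>osc_tableaux q l. real (wt11 T))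
      + real (psize p) * real (Suc l) * (\<Sum>q\<in>?N. \<Sum>T\<in>osc_tableaux q l. 1)"
    by (simp add: sum.distrib sum_distrib_left mult_ac)
  also have "(\<Sum>q\<in>?N. \<Sum>T\<in>osc_tableaux q l. 1) = real (card (osc_tableaux p (Suc l)))"
    using sum_osc_tableaux_Suc[OF Suc.prems, of "\<lambda>_. 1" l] by simp
  also have "\<dots> = num_syt (psize p) (row p) * osc_count (Suc l) (psize p)"
    by (rule card_osc_tableaux[OF Suc.prems])
  also have "(\<Sum>q\<in>?N. \<Sum>T\<in>osc_tableaux q l. real (wt11 T)) =
      (\<Sum>q\<in>?N. num_syt (psize q) (row q) * osc_weight l (psize q))"
    by (intro sum.cong refl Suc.IH) (auto simp: covers_def cocovers_def)
  finally show ?case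
    unfolding sum_neighbours[OF Suc.prems] by (simp add: algebra_simps)
qed

section \<open>Closed forms\<close>

text \<open>Starting from the empty partition, \<open>l\<close> steps create at most
  \<open>l\<close> cells.\<close>

lemma osc_count_eq_0: "l < k \<Longrightarrow> osc_count l k = 0"
  by (induction l arbitrary: k) (auto split: nat.split)

lemma osc_weight_eq_0: "l < k \<Longrightarrow> osc_weight l k = 0"
  by (induction l arbitrary: k) (auto simp: osc_count_eq_0 split: nat.split)

text \<open>The number of partial matchings of \<open>k + 2 * n\<close> points that leave \<open>k\<close> points single.\<close>

definition matching_count :: "nat \<Rightarrow> nat \<Rightarrow> real" where
  "matching_count k n = fact (k + 2 * n) / (fact k * fact n * 2 ^ n)"

text \<open>Counts matchings with a marked single point in two ways: deleting that point leaves
  \<open>k\<close> single points and \<open>n\<close> pairs.\<close>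

lemma matching_count_Suc_left:
  "real (Suc k + 2 * n) * matching_count k n = real (Suc k) * matching_count (Suc k) n"
  unfolding matching_count_def add_Suc fact_Suc by (simp del: of_nat_Suc)

text \<open>Counts matchings with a marked paired point in two ways: deleting that point makes its
  partner one of \<open>Suc k\<close> single points.\<close>

lemma matching_count_Suc_right:
  "real (k + 2 * Suc n) * (real (Suc k) * matching_count (Suc k) n) =
     2 * real (Suc n) * matching_count k (Suc n)"
proof -
  have "k + 2 * Suc n = Suc (Suc (k + 2 * n))" by simp
  then show ?thesis
    unfolding matching_count_def by (simp only: add_Suc fact_Suc power_Suc) (simp del: of_nat_Suc)
qed

text \<open>Real arguments make \<open>x - 1\<close> and \<open>y - 1\<close> honest subtractions,
  so the recursion below is a polynomial identity, valid also at the boundary.\<close>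

definition mean_weight :: "real \<Rightarrow> real \<Rightarrow> real" where
  "mean_weight x y = (x + 2 * y + 1) * ((2 * x ^ 2 + 2 * y ^ 2 + 5 * x * y + x) / 6)"

text \<open>The weight recursion divided by the count: the predecessor has size \<open>x - 1\<close>
  or \<open>x + 1\<close> with probabilities \<open>x / (x + 2 * y)\<close> and
  \<open>2 * y / (x + 2 * y)\<close>. Denominators are cleared.\<close>

lemma mean_weight_rec:
  "(x + 2 * y) * mean_weight x y =
     x * mean_weight (x - 1) y + 2 * y * mean_weight (x + 1) (y - 1) + x * (x + 2 * y) ^ 2"
  by (simp add: mean_weight_def field_simps power2_eq_square)

text \<open>Count and weight are treated in one induction because the weight recursion contains the
  count of the same length.\<close>

lemma osc_count_weight_closed_form:
  "k + 2 * n = l \<Longrightarrow> osc_count l k = matching_count k n \<and>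
     osc_weight l k = matching_count k n * mean_weight (real k) (real n)"
proof (induction l arbitrary: k n)
  case 0
  then show ?case by (simp add: matching_count_def mean_weight_def)
next
  case (Suc l)
  \<comment> \<open>\<open>c\<^sub>1\<close> and \<open>w\<^sub>1\<close> come from predecessors
    with one cell fewer, \<open>c\<^sub>2\<close> and \<open>w\<^sub>2\<close> from those with one
    cell more. Multiplying by \<open>?L\<close> avoids division.\<close>
  let ?c = "matching_count k n" and ?L = "real (Suc l)"
  define c\<^sub>1 where "c\<^sub>1 = (case k of 0 \<Rightarrow> 0 | Suc j \<Rightarrow> osc_count l j)"
  define c\<^sub>2 where "c\<^sub>2 = real (Suc k) * osc_count l (Suc k)"
  define w\<^sub>1 where "w\<^sub>1 = (case k of 0 \<Rightarrow> 0 | Suc j \<Rightarrow> osc_weight l j)"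
  define w\<^sub>2 where "w\<^sub>2 = real (Suc k) * osc_weight l (Suc k)"
  have L: "?L = real k + 2 * real n" using Suc.prems by (simp flip: Suc.prems)
  have c1: "?L * c\<^sub>1 = real k * ?c" and w1: "w\<^sub>1 = c\<^sub>1 * mean_weight (real k - 1) (real n)"
  proof -
    have "?L * c\<^sub>1 = real k * ?c \<and> w\<^sub>1 = c\<^sub>1 * mean_weight (real k - 1) (real n)"
    proof (cases k)
      case (Suc j)
      then have "j + 2 * n = l" using Suc.prems by simp
      from Suc.IH[OF this] show ?thesis
        using matching_count_Suc_left[of j n] Suc L by (simp add: c\<^sub>1_def w\<^sub>1_def)
    qed (simp add: c\<^sub>1_def w\<^sub>1_def)
    then show "?L * c\<^sub>1 = real k * ?c" "w\<^sub>1 = c\<^sub>1 * mean_weight (real k - 1) (real n)" by auto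
  qed
  have c2: "?L * c\<^sub>2 = 2 * real n * ?c" and w2: "w\<^sub>2 = c\<^sub>2 * mean_weight (real k + 1) (real n - 1)"
  proof -
    have "?L * c\<^sub>2 = 2 * real n * ?c \<and> w\<^sub>2 = c\<^sub>2 * mean_weight (real k + 1) (real n - 1)"
    proof (cases n)
      case 0
      \<comment> \<open>Here \<open>Suc k\<close> exceeds \<open>l\<close>, so there are no such
        predecessors, in agreement with the factor \<open>2 * real n\<close>.\<close>
      then show ?thesis
        using Suc.prems by (simp add: c\<^sub>2_def w\<^sub>2_def osc_count_eq_0 osc_weight_eq_0)
    next
      case (Suc m)
      then have "Suc k + 2 * m = l" using Suc.prems by simp
      from Suc.IH[OF this] show ?thesis
        using matching_count_Suc_right[of k m] Suc L by (simp add: c\<^sub>2_def w\<^sub>2_def add.commute)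
    qed
    then show "?L * c\<^sub>2 = 2 * real n * ?c" "w\<^sub>2 = c\<^sub>2 * mean_weight (real k + 1) (real n - 1)" by auto
  qed
  \<comment> \<open>The shares \<open>k\<close> and \<open>2 * n\<close> of the two kinds of
    predecessors add up to \<open>?L\<close>.\<close>
  have "?L * (c\<^sub>1 + c\<^sub>2) = ?L * ?c"
    unfolding distrib_left c1 c2 unfolding L by (simp add: algebra_simps)
  then have count: "osc_count (Suc l) k = ?c"
    by (simp add: c\<^sub>1_def c\<^sub>2_def)
  have "?L * (w\<^sub>1 + w\<^sub>2 + real k * ?L * ?c) =
      (?L * c\<^sub>1) * mean_weight (real k - 1) (real n) +
      (?L * c\<^sub>2) * mean_weight (real k + 1) (real n - 1) + real k * ?L ^ 2 * ?c"
    unfolding w1 w2 by (simp add: algebra_simps power2_eq_square)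
  also have "\<dots> = ?c * (real k * mean_weight (real k - 1) (real n)
      + 2 * real n * mean_weight (real k + 1) (real n - 1) + real k * ?L ^ 2)"
    unfolding c1 c2 by (simp only: algebra_simps)
  also have "\<dots> = ?L * (?c * mean_weight (real k) (real n))"
    unfolding L mean_weight_rec[symmetric] by simp
  \<comment> \<open>\<open>?L\<close> is the image of a successor, hence nonzero, and can be
    cancelled.\<close>
  finally have "w\<^sub>1 + w\<^sub>2 + real k * ?L * ?c = ?c * mean_weight (real k) (real n)"
    by (metis mult_cancel_left of_nat_eq_0_iff nat.distinct(1))
  then show ?case
    unfolding osc_weight.simps(2) count w\<^sub>1_def w\<^sub>2_def by simp
qed

theorem corollary1p6:
  fixes p :: "nat list" and k n :: nat
  assumes "is_partition p"
    and "k = psize p"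
  shows "1 / real (card (osc_tableaux p (k + 2 * n)))
           * (\<Sum>T\<in>osc_tableaux p (k + 2 * n). real (wt11 T))
         = (real k + 2 * real n + 1)
           * ((2 * real k ^ 2 + 2 * real n ^ 2 + 5 * real k * real n + real k) / 6)"
proof -
  \<comment> \<open>The product of these two factors is the number of tableaux and divides the total
    weight; being nonzero, it cancels and leaves \<open>mean_weight\<close>.\<close>
  have "num_syt k (row p) \<noteq> 0" "matching_count k n \<noteq> 0"
    using num_syt_pos[OF assms(1)] assms(2) by (auto simp: matching_count_def)
  then show ?thesis
    using osc_count_weight_closed_form[of k n "k + 2 * n"]
    by (simp add: card_osc_tableaux[OF assms(1)] sum_wt11_osc_tableaux[OF assms(1)]
        flip: assms(2)) (simp add: mean_weight_def)
qed

end
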